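(* Let $M\in\mathbb{R}^{n\times n}$ be symmetric positive definite with eigenvalues $\lambda_1\ge\lambda_2\ge\cdots\ge\lambda_n>0$, let $1\le r\le n-1$, and let $\widehat{M}$ be a maximal volume pseudo skeleton approximation of $M$ with parameters $p=q=r$. Suppose that there are positive real numbers $C_1,C_2$ and $s>0$ such that $$C_1\,k^{-s}\le\lambda_k\le C_2\,k^{-s}\qquad\text{for } k=1,\ldots,n.$$ Then $$\left\|\widehat{M}-M\right\|_C\le c\,\lambda_{r+1},\qquad c=(s+1)\frac{C_2}{C_1}.$$
   Context: Chebyshev norm: $\|X\|_C=\max_{i,j}|X_{i,j}|$. Pseudo skeleton approximation: let $M\in\mathbb{R}^{m\times n}$ and let $P_1\in\mathbb{R}^{m\times m}$, $P_2\in\mathbb{R}^{n\times n}$ be permutation matrices with $P_1MP_2^T=\begin{bmatrix}A&B\\C&D\end{bmatrix}$, $A\in\mathbb{R}^{p\times q}$. With $A^+$ the Moore-Penrose inverse of $A$, the matrix $\widehat{M}=P_1^T\begin{bmatrix}A\\C\end{bmatrix}A^+\begin{bmatrix}A&B\end{bmatrix}P_2$ is called a pseudo skeleton approximation of $M$ with parameters $p,q$. It is called a maximal volume approximation if $P_1,P_2$ are chosen (among all pairs of permutations) so that $\rho=\operatorname{rank}(A)$ is maximal and, subject to this, the $\rho$-volume $\operatorname{vol}_\rho(A)=\sigma_1(A)\cdots\sigma_\rho(A)$ is maximal, where $\sigma_1(A)\ge\sigma_2(A)\ge\cdots$ are the singular values of $A$. For symmetric positive definite $M\in\mathbb{R}^{n\times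 n}$ and $p=q$, the standing convention is that $A$ is a principal submatrix of $M$ with maximal volume, i.e. $P_1=P_2$. *)

theory Defs
  imports
    Complex_Main
    "HOL-Combinatorics.Permutations"
    "HOL-Computational_Algebra.Computational_Algebra"
    "Jordan_Normal_Form.Char_Poly"
    "Jordan_Normal_Form.DL_Rank"
begin

text \<open>The maximum of the empty set is unspecified, so this is the norm only if \<open>X\<close> has at least
  one entry.\<close>

definition chebyshev_norm :: "real mat \<Rightarrow> real" where
  "chebyshev_norm X = Max {\<bar>X $$ (i, j)\<bar> | i j. i < dim_row X \<and> j < dim_col X}"

definition symmetric_positive_definite :: "nat \<Rightarrow> real mat \<Rightarrow> bool" where
  "symmetric_positive_definite n M \<longleftrightarrow>
     M \<in> carrier_mat n n \<and> M\<^sup>T = M \<and>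
     (\<forall>x \<in> carrier_vec n. x \<noteq> 0\<^sub>v n \<longrightarrow> 0 < x \<bullet> (M *\<^sub>v x))"

text \<open>The real eigenvalues in decreasing order, each repeated according to its algebraic
  multiplicity. For a real symmetric matrix the length of this list is the dimension.\<close>

definition eigenvalues_desc :: "real mat \<Rightarrow> real list" where
  "eigenvalues_desc A = rev (sorted_list_of_multiset (proots (char_poly A)))"

text \<open>As square roots of the eigenvalues of \<open>A\<^sup>T A\<close>, the singular values of an
  \<open>m\<close> by \<open>n\<close> matrix form a list of length \<open>n\<close>; if \<open>m < n\<close>, the last \<open>n - m\<close> of them are zero.\<close>

definition singular_values :: "real mat \<Rightarrow> real list" where
  "singular_values A = map sqrt (eigenvalues_desc (A\<^sup>T * A))"

definition volume :: "nat \<Rightarrow> real mat \<Rightarrow> real" where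
  "volume k A = prod_list (take k (singular_values A))"

abbreviation mat_rank :: "real mat \<Rightarrow> nat" where
  "mat_rank A \<equiv> vec_space.rank (dim_row A) A"

text \<open>The Moore-Penrose inverse, characterized by the four Penrose equations.\<close>

definition is_moore_penrose_inverse :: "real mat \<Rightarrow> real mat \<Rightarrow> bool" where
  "is_moore_penrose_inverse A X \<longleftrightarrow>
     X \<in> carrier_mat (dim_col A) (dim_row A) \<and>
     A * X * A = A \<and> X * A * X = X \<and> (A * X)\<^sup>T = A * X \<and> (X * A)\<^sup>T = X * A"

definition moore_penrose_inverse :: "real mat \<Rightarrow> real mat" where
  "moore_penrose_inverse A = (THE X. is_moore_penrose_inverse A X)"

definition permutation_matrix :: "nat \<Rightarrow> real mat \<Rightarrow> bool" where
  "permutation_matrix n P \<longleftrightarrow>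
     (\<exists>\<pi>. \<pi> permutes {..<n} \<and> P = mat n n (\<lambda>(i, j). if j = \<pi> i then 1 else 0))"

definition append_columns :: "real mat \<Rightarrow> real mat \<Rightarrow> real mat" where
  "append_columns A B = four_block_mat A B (0\<^sub>m 0 (dim_col A)) (0\<^sub>m 0 (dim_col B))"

definition leading_block :: "nat \<Rightarrow> nat \<Rightarrow> real mat \<Rightarrow> real mat" where
  "leading_block p q N = (case split_block N p q of (A, B, C, D) \<Rightarrow> A)"

definition pseudo_skeleton ::
  "nat \<Rightarrow> nat \<Rightarrow> real mat \<Rightarrow> real mat \<Rightarrow> real mat \<Rightarrow> real mat" where
  "pseudo_skeleton p q P1 P2 M =
     (case split_block (P1 * M * P2\<^sup>T) p q of (A, B, C, D) \<Rightarrow>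
        P1\<^sup>T * (A @\<^sub>r C) * moore_penrose_inverse A * append_columns A B * P2)"

text \<open>The pair \<open>(P1, P2)\<close> maximizes, among all pairs of permutation matrices, first the rank of the
  leading block and then its volume of that order.\<close>

definition maximal_volume_pair ::
  "nat \<Rightarrow> nat \<Rightarrow> real mat \<Rightarrow> real mat \<Rightarrow> real mat \<Rightarrow> bool" where
  "maximal_volume_pair p q M P1 P2 \<longleftrightarrow>
     permutation_matrix (dim_row M) P1 \<and> permutation_matrix (dim_col M) P2 \<and>
     (\<forall>Q1 Q2. permutation_matrix (dim_row M) Q1 \<longrightarrow> permutation_matrix (dim_col M) Q2 \<longrightarrow>
        (let A = leading_block p q (P1 * M * P2\<^sup>T);
             A' = leading_block p q (Q1 * M * Q2\<^sup>T)
         in mat_rank A' < mat_rank A \<or>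
            mat_rank A' = mat_rank A \<and> volume (mat_rank A) A' \<le> volume (mat_rank A) A))"

text \<open>For a symmetric positive definite matrix the maximal volume block is required to be a
  principal submatrix, so both sides use the same permutation.\<close>

definition spd_maximal_volume_pseudo_skeleton :: "nat \<Rightarrow> real mat \<Rightarrow> real mat \<Rightarrow> bool" where
  "spd_maximal_volume_pseudo_skeleton r M Mhat \<longleftrightarrow>
     (\<exists>P. maximal_volume_pair r r M P P \<and> Mhat = pseudo_skeleton r r P P M)"

end

theory Submission
  imports Defs "Jordan_Normal_Form.Schur_Decomposition"
begin

text \<open>
  Let \<open>A\<close> be the maximal volume principal block and \<open>E = M - M V A\<^sup>-\<^sup>1 V\<^sup>T M\<close> the residual, where
  \<open>V\<close> selects the rows of \<open>A\<close>. As \<open>E\<close> is positive semidefinite, its largest entry is a diagonal one.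
  For an index \<open>i\<close> outside the block let \<open>N\<close> be \<open>A\<close> bordered by \<open>i\<close>. Then \<open>E\<^sub>i\<^sub>i = det N / det A\<close>,
  while each diagonal entry of \<open>N\<^sup>-\<^sup>1\<close> is \<open>det N' / det N\<close> for a principal block \<open>N'\<close> of order \<open>r\<close>, hence
  at most \<open>det A / det N = 1 / E\<^sub>i\<^sub>i\<close> by maximality. So \<open>E\<^sub>i\<^sub>i tr(N\<^sup>-\<^sup>1) \<le> r + 1\<close>.
  On the other hand \<open>tr(N\<^sup>-\<^sup>1) \<ge> \<Sum>\<^bsub>k \<le> r + 1\<^esub> 1 / \<lambda>\<^sub>k \<ge> \<Sum>\<^bsub>k \<le> r + 1\<^esub> k\<^sup>s / C\<^sub>2\<close>, and comparing the
  last sum with an integral bounds it below by \<open>(r + 1)\<^bsup>s + 1\<^esup> / ((s + 1) C\<^sub>2)\<close>.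
\<close>

section \<open>Real symmetric matrices\<close>

lemma congruence_symmetric:
  fixes A X :: "'a :: comm_semiring_0 mat"
  assumes A: "A \<in> carrier_mat n n" and sym: "A\<^sup>T = A" and X: "X \<in> carrier_mat n m"
  shows "(X\<^sup>T * A * X)\<^sup>T = X\<^sup>T * A * X"
proof -
  have "(X\<^sup>T * A * X)\<^sup>T = X\<^sup>T * (X\<^sup>T * A)\<^sup>T"
    using A X by (intro transpose_mult[of _ m n _ m]) auto
  also have "(X\<^sup>T * A)\<^sup>T = A * X"
    using A X sym by (subst transpose_mult[of _ m n _ n]) auto
  finally show ?thesis using A X by (simp add: assoc_mult_mat[of _ m n _ n _ m])
qed

lemma det_eq_prod_char_poly_roots: 
  fixes A :: "real mat"
  assumes A: "A \<in> carrier_mat n n" and c: "char_poly A = (\<Prod>a\<leftarrow>es. [:- a, 1:])"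
  shows "det A = prod_list es"
proof -
  obtain B P Q where s: "schur_decomposition A es = (B,P,Q)" by (cases "schur_decomposition A es") auto
  from schur_decomposition[OF A c s] have w: "similar_mat_wit A B P Q" and u: "upper_triangular B" and d: "diag_mat B = es" by auto
  have B: "B \<in> carrier_mat n n" using w A by (auto simp: similar_mat_wit_def Let_def)
  have "det A = det B" using w by (intro det_similar) (auto simp: similar_mat_def)
  thus ?thesis using det_upper_triangular[OF u B] d by simp
qed

lemma proots_linear_factors:
  fixes es :: "'a :: idom list"
  shows "proots (\<Prod>a\<leftarrow>es. [:- a, 1:]) = mset es"
proof (induction es)
  case (Cons a es)
  have "[:- a, 1:] \<noteq> 0" "(\<Prod>a\<leftarrow>es. [:- a, 1:]) \<noteq> 0"
    by (auto simp: prod_list_zero_iff)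
  from proots_mult[OF this] show ?case unfolding list.map prod_list.Cons Cons by simp
qed simp

lemma of_real_linear_factors:
  "map_poly of_real (\<Prod>a\<leftarrow>es. [:- a, 1:]) = (\<Prod>a\<leftarrow>es. [:- complex_of_real a, 1:])"
proof (induction es)
  case (Cons a es)
  interpret map_poly_comm_ring_hom complex_of_real ..
  show ?case unfolding list.map prod_list.Cons hom_mult Cons by simp
qed simp

text \<open>The pairing of \<open>?A *\<^sub>v v\<close> with \<open>conjugate v\<close> is
  evaluated in two ways: symmetry moves the matrix across, and real entries let it commute with
  conjugation. One side yields \<open>a\<close>, the other \<open>cnj a\<close>.\<close>

lemma real_symmetric_eigenvalue_real:
  fixes A :: "real mat"
  assumes A: "A \<in> carrier_mat n n" and sym: "A\<^sup>T = A"
    and ev: "eigenvalue (map_mat complex_of_real A) a"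
  shows "a \<in> \<real>"
proof -
  let ?A = "map_mat complex_of_real A"
  from ev obtain v where v: "v \<in> carrier_vec n" "v \<noteq> 0\<^sub>v n" "?A *\<^sub>v v = a \<cdot>\<^sub>v v"
    using A unfolding eigenvalue_def eigenvector_def by auto
  have AC: "?A \<in> carrier_mat n n" using A by simp
  have AT: "?A\<^sup>T = ?A" using sym by (metis map_mat_transpose)
  have cA: "conjugate (?A *\<^sub>v v) = ?A *\<^sub>v conjugate v"
    using A v(1) by (intro eq_vecI) (auto simp: scalar_prod_def intro!: sum.cong)
  have "a * (v \<bullet> conjugate v) = (?A *\<^sub>v v) \<bullet> conjugate v"
    using v by (simp add: smult_scalar_prod_distrib[of _ n])
  also have "\<dots> = conjugate v \<bullet> (?A *\<^sub>v v)"
    using v AC by (intro comm_scalar_prod[of _ n]) auto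
  also have "\<dots> = (?A\<^sup>T *\<^sub>v conjugate v) \<bullet> v"
    using v AC by (subst transpose_vec_mult_scalar[of _ n n]) auto
  also have "\<dots> = conjugate (a \<cdot>\<^sub>v v) \<bullet> v"
    using AT cA v by simp
  also have "\<dots> = cnj a * (v \<bullet> conjugate v)"
    using v by (simp add: conjugate_smult_vec smult_scalar_prod_distrib[of _ n] comm_scalar_prod[of v n])
  finally have "a * (v \<bullet> conjugate v) = cnj a * (v \<bullet> conjugate v)" .
  moreover have "v \<bullet> conjugate v \<noteq> 0" using v conjugate_square_eq_0_vec[of v n] by auto
  ultimately show ?thesis by (metis mult_cancel_right Reals_cnj_iff)
qed

text \<open>The factorization exists over the complex numbers. All roots turn out real, and the
  embedding of real polynomials is injective, so the factorization descends.\<close>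

lemma real_symmetric_char_poly_splits:
  fixes A :: "real mat"
  assumes A: "A \<in> carrier_mat n n" and sym: "A\<^sup>T = A"
  obtains es where "char_poly A = (\<Prod>a\<leftarrow>es. [:- a, 1:])" "length es = n"
proof -
  let ?A = "map_mat complex_of_real A"
  have AC: "?A \<in> carrier_mat n n" using A by simp
  from char_poly_factorized[OF AC] obtain as where
    as: "char_poly ?A = (\<Prod>a\<leftarrow>as. [:- a, 1:])" "length as = n" by auto
  have real: "a \<in> \<real>" if "a \<in> set as" for a
  proof -
    have "poly (char_poly ?A) a = 0"
      using that unfolding as(1) by (auto simp: poly_prod_list prod_list_zero_iff)
    hence "eigenvalue ?A a" using eigenvalue_root_char_poly[OF AC] by simp
    thus ?thesis using real_symmetric_eigenvalue_real[OF A sym] by blast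
  qed
  have map: "as = map complex_of_real (map Re as)"
    using real by (auto simp: o_def intro!: nth_equalityI)
  have "map_poly complex_of_real (char_poly A) = char_poly ?A"
    using of_real_hom.char_poly_hom[OF A] by metis
  also have "\<dots> = map_poly complex_of_real (\<Prod>a\<leftarrow>map Re as. [:- a, 1:])"
    unfolding of_real_linear_factors as(1) by (subst map) (simp add: o_def)
  finally have "char_poly A = (\<Prod>a\<leftarrow>map Re as. [:- a, 1:])"
    by (simp add: poly_eq_iff coeff_map_poly)
  thus thesis using as(2) by (intro that[of "map Re as"]) simp_all
qed

text \<open>\<open>eigenvalues_desc\<close> collects only real roots; the splitting ensures that
  none is lost.\<close>

lemma eigenvalues_desc_symmetric:
  assumes A: "A \<in> carrier_mat n n" and sym: "A\<^sup>T = A"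
  shows "char_poly A = (\<Prod>a\<leftarrow>eigenvalues_desc A. [:- a, 1:])"
    and "length (eigenvalues_desc A) = n"
    and "sorted_wrt (\<ge>) (eigenvalues_desc A)"
proof -
  obtain es where es: "char_poly A = (\<Prod>a\<leftarrow>es. [:- a, 1:])" "length es = n"
    using real_symmetric_char_poly_splits[OF A sym] .
  have m: "mset (eigenvalues_desc A) = mset es"
    unfolding eigenvalues_desc_def es(1) proots_linear_factors by simp
  show "length (eigenvalues_desc A) = n" using mset_eq_length[OF m] es by simp
  have "mset (map (\<lambda>a. [:- a, 1:]) (eigenvalues_desc A)) = mset (map (\<lambda>a. [:- a, 1:]) es)"
    using m by simp
  thus "char_poly A = (\<Prod>a\<leftarrow>eigenvalues_desc A. [:- a, 1:])"
    unfolding es(1) by (metis prod_mset_prod_list)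
  show "sorted_wrt (\<ge>) (eigenvalues_desc A)"
    unfolding eigenvalues_desc_def by (simp add: sorted_wrt_rev)
qed

text \<open>Converts maximal volume into maximal determinant: the product of all singular values is
  the square root of the determinant of \<open>A\<^sup>T * A\<close>.\<close>

lemma volume_square:
  assumes A: "A \<in> carrier_mat n n"
  shows "volume n A = \<bar>det A\<bar>"
proof -
  have S: "A\<^sup>T * A \<in> carrier_mat n n" and sym: "(A\<^sup>T * A)\<^sup>T = A\<^sup>T * A"
    using A by (auto simp: transpose_mult[of _ n n])
  note ev = eigenvalues_desc_symmetric[OF S sym]
  \<comment> \<open>\<open>sqrt\<close> is extended to negative reals as an odd function and so is
    multiplicative on all reals.\<close>
  have "prod_list (map sqrt xs) = sqrt (prod_list xs)" for xs
    by (induction xs) (auto simp: real_sqrt_mult)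
  hence "volume n A = sqrt (det (A\<^sup>T * A))"
    unfolding volume_def singular_values_def
    using det_eq_prod_char_poly_roots[OF S ev(1)] ev(2) by simp
  thus ?thesis using A by (simp add: det_mult[of _ n] det_transpose)
qed

text \<open>Supplies the change of basis for deflation. Gram-Schmidt keeps the first vector of a
  basis starting with \<open>v\<close>, and normalizing it produces the factor
  \<open>c\<close>.\<close>

lemma orthogonal_completion:
  fixes v :: "real vec"
  assumes v: "v \<in> carrier_vec n" and v0: "v \<noteq> 0\<^sub>v n"
  obtains W c where "W \<in> carrier_mat n n" "W\<^sup>T * W = 1\<^sub>m n" "col W 0 = c \<cdot>\<^sub>v v"
proof -
  interpret cof_vec_space n "TYPE(real)" .
  have n: "n > 0" using v v0 by (cases n) auto
  define b where "b = basis_completion v"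
  define ws where "ws = gram_schmidt n b"
  from basis_completion[OF v v0, folded b_def]
  have dist_b: "distinct b" and indep: "\<not> lin_dep (set b)" and b: "set b \<subseteq> carrier_vec n"
    and hdb: "hd b = v" and len_b: "length b = n" by auto
  from hdb len_b n obtain vs where bv: "b = v # vs" by (cases b) auto
  from gram_schmidt_result[OF b dist_b indep refl, folded ws_def]
  have ws: "set ws \<subseteq> carrier_vec n" "corthogonal ws" "length ws = n"
    by (auto simp: len_b)
  have hdws: "hd ws = v" using gram_schmidt_hd[OF v, of vs, folded bv] unfolding ws_def .
  have wsc: "ws ! i \<in> carrier_vec n" if "i < n" for i using ws that by auto
  define d where "d = (\<lambda>i. 1 / sqrt (ws ! i \<bullet> ws ! i))"
  define W where "W = mat_of_cols n (map (\<lambda>i. d i \<cdot>\<^sub>v ws ! i) [0..<n])"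
  have W: "W \<in> carrier_mat n n" unfolding W_def by (simp add: mat_of_cols_def)
  have col: "col W i = d i \<cdot>\<^sub>v ws ! i" if "i < n" for i
    unfolding W_def using that wsc by (subst col_mat_of_cols) auto
  \<comment> \<open>\<open>corthogonal\<close> also excludes vanishing norms, hence the
    equivalence.\<close>
  have orth: "ws ! i \<bullet> ws ! j = 0 \<longleftrightarrow> i \<noteq> j" if "i < n" "j < n" for i j
    using corthogonalD[OF ws(2), of i j] ws(3) that
    by simp
  have unit: "d i * (d i * (ws ! i \<bullet> ws ! i)) = 1" if "i < n" for i
  proof -
    have "ws ! i \<bullet> ws ! i > 0"
      using orth[OF that that] conjugate_square_ge_0_vec[of "ws ! i"] by simp
    thus ?thesis unfolding d_def by (simp add: field_simps)
  qed
  have "col W i \<bullet> col W j = (if i = j then 1 else 0)" if "i < n" "j < n" for i j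
    using that col wsc orth[OF that] unit
    by (simp add: smult_scalar_prod_distrib[of _ n] scalar_prod_smult_distrib[of _ n])
  hence "W\<^sup>T * W = 1\<^sub>m n" using W by (intro eq_matI) auto
  moreover have "col W 0 = d 0 \<cdot>\<^sub>v v"
    using col[OF n] hdws ws(3) n hd_conv_nth[of ws] by auto
  ultimately show thesis using W that by blast
qed

text \<open>Deflation: an orthogonal matrix whose first column is an eigenvector splits off a block
  of order 1, and induction on the list of roots handles the rest. The list is prescribed so that
  the diagonal can later be taken in decreasing order.\<close>

lemma spectral_theorem_symmetric:
  fixes A :: "real mat"
  assumes "A \<in> carrier_mat n n" and "A\<^sup>T = A" and "char_poly A = (\<Prod>a\<leftarrow>es. [:- a, 1:])"
  shows "\<exists>U \<in> carrier_mat n n. U\<^sup>T * U = 1\<^sub>m n \<and> U\<^sup>T * A * U = mat_diag n (\<lambda>i. es ! i)"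
  using assms
proof (induction es arbitrary: n A)
  case Nil
  hence "n = 0" using degree_monic_char_poly[of A n] by auto
  thus ?case using Nil by (intro bexI[of _ "1\<^sub>m n"]) (auto intro!: eq_matI simp: mat_diag_def)
next
  case (Cons e es n A)
  note A = Cons.prems(1) and sym = Cons.prems(2)
  have cp: "char_poly A = [:- e, 1:] * (\<Prod>a\<leftarrow>es. [:- a, 1:])" using Cons.prems(3) by simp
  have e: "eigenvalue A e"
    unfolding eigenvalue_root_char_poly[OF A] cp by simp
  then obtain v where v: "v \<in> carrier_vec n" "v \<noteq> 0\<^sub>v n" "A *\<^sub>v v = e \<cdot>\<^sub>v v"
    using A unfolding eigenvalue_def eigenvector_def by auto
  obtain W c where W: "W \<in> carrier_mat n n" and WW: "W\<^sup>T * W = 1\<^sub>m n" and W0: "col W 0 = c \<cdot>\<^sub>v v"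
    using orthogonal_completion[OF v(1,2)] .
  obtain m where n: "n = Suc m" using v by (cases n) auto
  have WW': "W * W\<^sup>T = 1\<^sub>m n" using mat_mult_left_right_inverse[of "W\<^sup>T" n W] W WW by auto
  define A' where "A' = W\<^sup>T * A * W"
  have A': "A' \<in> carrier_mat n n" using W A by (auto simp: A'_def)
  have sym': "A'\<^sup>T = A'" unfolding A'_def using congruence_symmetric[OF A sym W] .
  have sim: "similar_mat A A'"
  proof -
    have "W * A' * W\<^sup>T = (W * W\<^sup>T) * A * (W * W\<^sup>T)"
      unfolding A'_def using W A by (simp add: assoc_mult_mat[of _ n n _ n _ n])
    hence "A = W * A' * W\<^sup>T" using A unfolding WW' by simp
    thus ?thesis unfolding similar_mat_def
      using A A' W WW WW' by (intro exI[of _ W] exI[of _ "W\<^sup>T"] similar_mat_witI[of _ _ n]) auto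
  qed
  have ev: "A *\<^sub>v col W 0 = e \<cdot>\<^sub>v col W 0"
    unfolding W0 using v A by (simp add: mult_mat_vec smult_smult_assoc mult.commute)
  \<comment> \<open>The first column of \<open>W\<close> is an eigenvector and the columns are
    orthonormal, which clears the first column of \<open>A'\<close> below the diagonal; symmetry
    then clears the first row.\<close>
  have c0: "A' $$ (i, 0) = (if i = 0 then e else 0)" if i: "i < n" for i
  proof -
    have "A' $$ (i, 0) = (W\<^sup>T * (A * W)) $$ (i, 0)"
      unfolding A'_def using A W by (simp add: assoc_mult_mat[of _ n n _ n _ n])
    also have "\<dots> = col W i \<bullet> (A *\<^sub>v col W 0)" using i n A W by (simp add: mult_mat_vec_def)
    also have "\<dots> = e * ((W\<^sup>T * W) $$ (i, 0))" unfolding ev using i n W by simp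
    finally show ?thesis unfolding WW using i n by simp
  qed
  define A3 where "A3 = mat m m (\<lambda>(i,j). A' $$ (Suc i, Suc j))"
  define A1 where "A1 = mat 1 1 (\<lambda>_::nat \<times> nat. e)"
  have A3: "A3 \<in> carrier_mat m m" and A1: "A1 \<in> carrier_mat 1 1" by (auto simp: A3_def A1_def)
  have r0: "A' $$ (0, j) = (if j = 0 then e else 0)" if "j < n" for j
    using c0[OF that] A' n that sym' index_transpose_mat(1)[of 0 A' j] by auto
  have block: "A' = four_block_mat A1 (0\<^sub>m 1 m) (0\<^sub>m m 1) A3"
    using A' n by (intro eq_matI) (auto simp: A1_def A3_def c0 r0)
  have "[:- e, 1:] * (\<Prod>a\<leftarrow>es. [:- a, 1:]) = char_poly A1 * char_poly A3"
    using char_poly_four_block_zeros_col[OF A1 _ A3, of "0\<^sub>m 1 m", folded block]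
      char_poly_similar[OF sim] cp by simp
  also have "char_poly A1 = [:- e, 1:]"
    by (simp add: A1_def char_poly_defs det_def sign_def)
  finally have cp3: "char_poly A3 = (\<Prod>a\<leftarrow>es. [:- a, 1:])"
    by (metis mult_cancel_left pCons_eq_0_iff zero_neq_one)
  have sym3: "A3\<^sup>T = A3"
    using sym' A' n unfolding A3_def
    by (intro eq_matI) (auto, metis Suc_less_eq carrier_matD index_transpose_mat(1))
  obtain U where U: "U \<in> carrier_mat m m" and UU: "U\<^sup>T * U = 1\<^sub>m m"
    and UA: "U\<^sup>T * A3 * U = mat_diag m (\<lambda>i. es ! i)"
    using Cons.IH[OF A3 sym3 cp3] by blast
  \<comment> \<open>\<open>F\<close> applies the diagonalizer of the smaller block and fixes the
    coordinate split off; \<open>W * F\<close> is the required orthogonal matrix.\<close>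
  define F where "F = four_block_mat (1\<^sub>m 1) (0\<^sub>m 1 m) (0\<^sub>m m 1) U"
  have F: "F \<in> carrier_mat n n" using U n by (auto simp: F_def)
  have FT: "F\<^sup>T = four_block_mat (1\<^sub>m 1) (0\<^sub>m 1 m) (0\<^sub>m m 1) U\<^sup>T"
    unfolding F_def using U by (subst transpose_four_block_mat[of _ 1 1 _ m _ m]) auto
  have FF: "F\<^sup>T * F = 1\<^sub>m n"
    unfolding FT unfolding F_def using U UU n
    by (subst mult_four_block_mat[of _ 1 1 _ m _ m _ _ 1 _ m]) (auto simp: four_block_one_mat)
  have "F\<^sup>T * A' * F = four_block_mat A1 (0\<^sub>m 1 m) (0\<^sub>m m 1) (U\<^sup>T * A3 * U)"
    unfolding FT block unfolding F_def using U A1 A3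
    by (simp add: mult_four_block_mat[of _ 1 1 _ m _ m _ _ 1 _ m])
  also have "\<dots> = mat_diag n (\<lambda>i. (e # es) ! i)"
    unfolding UA using n by (intro eq_matI) (auto simp: A1_def mat_diag_def nth_Cons')
  finally have FAF: "F\<^sup>T * A' * F = mat_diag n (\<lambda>i. (e # es) ! i)" .
  have "(W * F)\<^sup>T * (W * F) = F\<^sup>T * (W\<^sup>T * W) * F"
    using W F by (simp add: transpose_mult[of _ n n] assoc_mult_mat[of _ n n _ n _ n])
  hence "(W * F)\<^sup>T * (W * F) = 1\<^sub>m n" using F FF unfolding WW by simp
  moreover have "(W * F)\<^sup>T * A * (W * F) = F\<^sup>T * A' * F"
    using W F A unfolding A'_def by (simp add: transpose_mult[of _ n n] assoc_mult_mat[of _ n n _ n _ n])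
  ultimately show ?case using W F FAF by (intro bexI[of _ "W * F"]) auto
qed

section \<open>Traces of inverses of compressions\<close>

lemma trace_mult_commute:
  fixes A B :: "'a :: comm_semiring_0 mat"
  assumes A: "A \<in> carrier_mat n m" and B: "B \<in> carrier_mat m n"
  shows "(\<Sum>i<n. (A * B) $$ (i, i)) = (\<Sum>j<m. (B * A) $$ (j, j))"
proof -
  have "(\<Sum>i<n. (A * B) $$ (i, i)) = (\<Sum>i<n. \<Sum>j<m. A $$ (i, j) * B $$ (j, i))"
    using A B by (auto simp: scalar_prod_def atLeast0LessThan intro!: sum.cong)
  also have "\<dots> = (\<Sum>j<m. \<Sum>i<n. B $$ (j, i) * A $$ (i, j))"
    by (subst sum.swap) (simp add: mult.commute)
  also have "\<dots> = (\<Sum>j<m. (B * A) $$ (j, j))"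
    using A B by (auto simp: scalar_prod_def atLeast0LessThan intro!: sum.cong)
  finally show ?thesis .
qed

lemma mat_mult_entry:
  assumes "A \<in> carrier_mat n m" "B \<in> carrier_mat m k" "i < n" "j < k"
  shows "(A * B) $$ (i, j) = (\<Sum>l<m. A $$ (i, l) * B $$ (l, j))"
  using assms by (simp add: scalar_prod_def atLeast0LessThan)

lemma mat_mult_vec_entry:
  assumes "A \<in> carrier_mat n m" "v \<in> carrier_vec m" "i < n"
  shows "(A *\<^sub>v v) $ i = (\<Sum>l<m. A $$ (i, l) * v $ l)"
  using assms by (simp add: scalar_prod_def atLeast0LessThan)

lemma mat_mult_eq_one_commute:
  fixes A B :: "'a :: field mat"
  assumes "A \<in> carrier_mat n n" "B \<in> carrier_mat n n" "A * B = 1\<^sub>m n"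
  shows "B * A = 1\<^sub>m n"
  using mat_mult_left_right_inverse assms by blast

lemma mat_inverse_unique:
  fixes N K L :: "'a :: field mat"
  assumes N: "N \<in> carrier_mat n n" and K: "K \<in> carrier_mat n n" and L: "L \<in> carrier_mat n n"
    and "K * N = 1\<^sub>m n" and "N * L = 1\<^sub>m n"
  shows "K = L"
proof -
  have "K = K * (N * L)" using K unfolding \<open>N * L = 1\<^sub>m n\<close> by simp
  also have "\<dots> = (K * N) * L" using N K L by (simp add: assoc_mult_mat[of _ n n _ n _ n])
  finally show ?thesis using assms by simp
qed

lemma inverse_symmetric:
  fixes N K :: "'a :: field mat"
  assumes N: "N \<in> carrier_mat n n" and K: "K \<in> carrier_mat n n"
    and sym: "N\<^sup>T = N" and inv: "K * N = 1\<^sub>m n"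
  shows "K\<^sup>T = K"
proof -
  have "N * K\<^sup>T = (K * N)\<^sup>T" using N K sym by (simp add: transpose_mult[of _ n n])
  thus ?thesis using mat_inverse_unique[OF N K, of "K\<^sup>T"] K inv by simp
qed

text \<open>A bathtub argument: \<open>1 / l i\<close> grows with \<open>i\<close>, so weights in
  [0, 1] of total mass \<open>k\<close> cost least when they fill the first \<open>k\<close>
  places.\<close>

lemma weighted_sum_inverse_decreasing:
  fixes p l :: "nat \<Rightarrow> real"
  assumes p0: "\<And>i. i < n \<Longrightarrow> 0 \<le> p i" and p1: "\<And>i. i < n \<Longrightarrow> p i \<le> 1"
    and sum: "(\<Sum>i<n. p i) = real k" and kn: "k \<le> n"
    and pos: "\<And>i. i < n \<Longrightarrow> 0 < l i"
    and dec: "\<And>i j. i \<le> j \<Longrightarrow> j < n \<Longrightarrow> l j \<le> l i"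
  shows "(\<Sum>i<k. 1 / l i) \<le> (\<Sum>i<n. p i / l i)"
proof (cases k)
  case 0
  thus ?thesis using p0 pos by (auto intro!: sum_nonneg simp: less_imp_le)
next
  case (Suc m)
  \<comment> \<open>The threshold value at index \<open>k - 1\<close>. After subtracting it the
    terms are at most 0 below \<open>k\<close> and at least 0 from \<open>k\<close> on; both sides
    lose the same \<open>c * k\<close> because their total weights agree.\<close>
  define c where "c = 1 / l m"
  have low: "1 / l i \<le> c" if "i < k" for i
    unfolding c_def using dec[of i m] that pos[of m] Suc kn by (intro divide_left_mono) (auto intro: pos)
  have high: "c \<le> 1 / l i" if "k \<le> i" "i < n" for i
    unfolding c_def using dec[of m i] that pos[of i] pos[of m] Suc by (intro divide_left_mono) auto
  have split: "{..<n} = {..<k} \<union> {k..<n}" using kn by auto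
  have "(\<Sum>i<k. 1 / l i - c) \<le> (\<Sum>i<k. p i * (1 / l i - c))"
  proof (rule sum_mono)
    fix i assume "i \<in> {..<k}"
    hence "i < k" "i < n" using kn by auto
    hence "0 \<le> (1 - p i) * (c - 1 / l i)" using p1 low by (intro mult_nonneg_nonneg) auto
    also have "\<dots> = p i * (1 / l i - c) - (1 / l i - c)" by (simp add: algebra_simps add_divide_distrib diff_divide_distrib)
    finally show "1 / l i - c \<le> p i * (1 / l i - c)" by simp
  qed
  moreover have "0 \<le> (\<Sum>i=k..<n. p i * (1 / l i - c))"
    using p0 high by (intro sum_nonneg mult_nonneg_nonneg) auto
  ultimately have "(\<Sum>i<k. 1 / l i - c) \<le> (\<Sum>i<n. p i * (1 / l i - c))"
    unfolding split by (subst sum.union_disjoint) auto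
  also have "\<dots> = (\<Sum>i<n. p i / l i) - c * real k"
    unfolding sum[symmetric] by (simp add: right_diff_distrib sum_subtractf sum_distrib_left mult.commute)
  finally show ?thesis by (simp add: sum_subtractf mult.commute)
qed

text \<open>In the eigenbasis of \<open>M\<close>, with \<open>Y = U\<^sup>T W\<close>, the numbers \<open>p\<^sub>i = l\<^sub>i (Y K Y\<^sup>T)\<^sub>i\<^sub>i\<close> are the diagonal of
  the orthogonal projector \<open>L\<^bsup>1/2\<^esup> Y K Y\<^sup>T L\<^bsup>1/2\<^esup>\<close> of rank \<open>k\<close>, so they lie in \<open>[0, 1]\<close> and sum to \<open>k\<close>,
  whereas \<open>tr K = \<Sum> p\<^sub>i / l\<^sub>i\<close>. This replaces Cauchy interlacing.\<close>

lemma trace_inverse_compression: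
  fixes M W K U :: "real mat" and l :: "nat \<Rightarrow> real"
  assumes M: "M \<in> carrier_mat n n" and U: "U \<in> carrier_mat n n" and UU: "U\<^sup>T * U = 1\<^sub>m n"
    and D: "U\<^sup>T * M * U = mat_diag n l"
    and pos: "\<And>i. i < n \<Longrightarrow> 0 < l i"
    and dec: "\<And>i j. i \<le> j \<Longrightarrow> j < n \<Longrightarrow> l j \<le> l i"
    and W: "W \<in> carrier_mat n k" and WW: "W\<^sup>T * W = 1\<^sub>m k" and kn: "k \<le> n"
    and K: "K \<in> carrier_mat k k" and Ksym: "K\<^sup>T = K" and KN: "K * (W\<^sup>T * M * W) = 1\<^sub>m k"
  shows "(\<Sum>i<k. 1 / l i) \<le> (\<Sum>i<k. K $$ (i, i))"
proof -
  note am = assoc_mult_mat[of _ n n _ n _ n] assoc_mult_mat[of _ n n _ n _ k]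
    assoc_mult_mat[of _ n n _ k _ k] assoc_mult_mat[of _ n n _ k _ n] assoc_mult_mat[of _ n k _ k _ k]
    assoc_mult_mat[of _ n k _ n _ n] assoc_mult_mat[of _ n k _ n _ k] assoc_mult_mat[of _ n k _ k _ n]
    assoc_mult_mat[of _ k n _ n _ n] assoc_mult_mat[of _ k n _ n _ k] assoc_mult_mat[of _ k n _ k _ k]
    assoc_mult_mat[of _ k n _ k _ n] assoc_mult_mat[of _ k k _ n _ n] assoc_mult_mat[of _ k k _ n _ k]
    assoc_mult_mat[of _ k k _ k _ n] assoc_mult_mat[of _ k k _ k _ k]
  define N where "N = W\<^sup>T * M * W"
  define L where "L = mat_diag n l"
  define Y where "Y = U\<^sup>T * W"
  define R where "R = Y * K * Y\<^sup>T"
  have N: "N \<in> carrier_mat k k" and L: "L \<in> carrier_mat n n" and Y: "Y \<in> carrier_mat n k"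
    using M W U by (auto simp: N_def L_def Y_def)
  have R: "R \<in> carrier_mat n n" using Y K by (auto simp: R_def)
  have UU': "U * U\<^sup>T = 1\<^sub>m n" using mat_mult_eq_one_commute[of "U\<^sup>T" n U] U UU by auto
  have UUX: "U * (U\<^sup>T * X) = X" if "X \<in> carrier_mat n m" for X m
    using assoc_mult_mat[of U n n "U\<^sup>T" n X m] U UU' that by simp
  have YT: "Y\<^sup>T = W\<^sup>T * U" unfolding Y_def using U W by (simp add: transpose_mult[of _ n n])
  have YY: "Y\<^sup>T * Y = 1\<^sub>m k" unfolding YT unfolding Y_def using U W WW by (simp add: am UUX[of _ k])
  have YLY: "Y\<^sup>T * L * Y = N" unfolding YT unfolding Y_def L_def N_def D[symmetric]
    using U W M by (simp add: am UUX[of _ k])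
  have NK: "N * K = 1\<^sub>m k" using mat_mult_eq_one_commute[OF K N] KN N_def by simp
  have "(\<Sum>i<n. R $$ (i, i)) = (\<Sum>i<k. (Y\<^sup>T * (Y * K)) $$ (i, i))"
    unfolding R_def using Y K by (intro trace_mult_commute) auto
  also have "Y\<^sup>T * (Y * K) = K" using Y K YY assoc_mult_mat[of "Y\<^sup>T" k n Y k K k] by simp
  finally have trR: "(\<Sum>i<n. R $$ (i, i)) = (\<Sum>i<k. K $$ (i, i))" .
  have RL: "(R * L) $$ (i, j) = R $$ (i, j) * l j" if "i < n" "j < n" for i j
    unfolding L_def using R that by (simp add: mat_diag_mult_right[of _ n n])
  \<comment> \<open>Cyclicity of the trace turns \<open>R * L\<close> into \<open>N * K\<close>, the
    identity of order \<open>k\<close>; this fixes the total weight.\<close>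
  have "R * L = (Y * K) * (Y\<^sup>T * L)" unfolding R_def using Y K L by (simp add: am)
  hence "(\<Sum>i<n. (R * L) $$ (i, i)) = (\<Sum>i<k. ((Y\<^sup>T * L) * (Y * K)) $$ (i, i))"
    using Y K L by (simp only:) (intro trace_mult_commute, auto)
  also have "(Y\<^sup>T * L) * (Y * K) = Y\<^sup>T * L * Y * K" using Y K L by (simp add: am)
  also have "\<dots> = 1\<^sub>m k" unfolding YLY NK ..
  finally have sum: "(\<Sum>i<n. R $$ (i, i) * l i) = real k" using RL by simp
  have Rsym: "R $$ (i, j) = R $$ (j, i)" if "i < n" "j < n" for i j
  proof -
    have "R\<^sup>T = R" unfolding R_def using congruence_symmetric[OF K Ksym, of "Y\<^sup>T" n] Y by simp
    thus ?thesis using that R by (metis carrier_matD index_transpose_mat(1))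
  qed
  \<comment> \<open>Idempotence of the projector, stated without square roots of
    \<open>L\<close>.\<close>
  have "R * L * R = Y * (K * (Y\<^sup>T * L * Y)) * (K * Y\<^sup>T)"
    unfolding R_def using Y K L by (simp add: am)
  also have "\<dots> = R" using Y K YLY KN by (simp add: R_def N_def am)
  finally have RLR: "R * L * R = R" .
  have diag: "R $$ (i, i) = (\<Sum>j<n. l j * (R $$ (i, j))\<^sup>2)" if "i < n" for i
  proof -
    have "R $$ (i, i) = (R * L * R) $$ (i, i)" unfolding RLR ..
    also have "\<dots> = (\<Sum>j<n. (R * L) $$ (i, j) * R $$ (j, i))"
      using R L that by (intro mat_mult_entry[of _ n]) auto
    also have "\<dots> = (\<Sum>j<n. l j * (R $$ (i, j))\<^sup>2)"
      using that RL Rsym by (intro sum.cong) (auto simp: power2_eq_square)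
    finally show ?thesis .
  qed
  define p where "p = (\<lambda>i. R $$ (i, i) * l i)"
  have p0: "0 \<le> p i" if "i < n" for i
    using diag[OF that] pos that unfolding p_def
    by (auto intro!: mult_nonneg_nonneg sum_nonneg simp: less_imp_le)
  have p1: "p i \<le> 1" if "i < n" for i
  proof -
    \<comment> \<open>Only the summand \<open>j = i\<close> of \<open>diag\<close> is kept;
      multiplication by \<open>l i\<close> then gives \<open>p i * p i \<le> p i\<close>.\<close>
    have "l i * (R $$ (i, i))\<^sup>2 \<le> R $$ (i, i)"
      unfolding diag[OF that, symmetric]
      by (subst diag[OF that], rule member_le_sum) (use that pos in \<open>auto simp: less_imp_le\<close>)
    hence "p i * p i \<le> p i * 1"
      using mult_left_mono[of _ _ "l i"] pos[OF that]
      by (fastforce simp: p_def power2_eq_square algebra_simps)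
    thus ?thesis using p0[OF that] by (cases "p i = 0") (auto simp: mult_le_cancel_left)
  qed
  have "(\<Sum>i<k. 1 / l i) \<le> (\<Sum>i<n. p i / l i)"
    by (rule weighted_sum_inverse_decreasing[OF p0 p1 _ kn pos dec]) (use sum in \<open>auto simp: p_def\<close>)
  also have "\<dots> = (\<Sum>i<n. R $$ (i, i))"
    using pos by (intro sum.cong) (force simp: p_def)+
  finally show ?thesis unfolding trR .
qed

section \<open>Principal submatrices of maximal volume\<close>

text \<open>Index functions instead of index sets make bordering a block, or deleting a row and the
  same column, a plain reindexing.\<close>

definition principal_sub :: "'a mat \<Rightarrow> (nat \<Rightarrow> nat) \<Rightarrow> nat \<Rightarrow> 'a mat" where
  "principal_sub M f k = mat k k (\<lambda>(i, j). M $$ (f i, f j))"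

text \<open>The columns are the unit vectors at \<open>f 0\<close>, \<open>f 1\<close> and so on.
  Principal blocks thus become congruences \<open>V\<^sup>T * M * V\<close>, and permutation
  matrices are transposes of the case \<open>k = n\<close>.\<close>

definition selection_mat :: "nat \<Rightarrow> (nat \<Rightarrow> nat) \<Rightarrow> nat \<Rightarrow> real mat" where
  "selection_mat n f k = mat n k (\<lambda>(i, a). if i = f a then 1 else 0)"

lemma principal_sub_carrier [simp]: "principal_sub M f k \<in> carrier_mat k k"
  by (simp add: principal_sub_def)

lemma principal_sub_dim [simp]:
  "dim_row (principal_sub M f k) = k" "dim_col (principal_sub M f k) = k"
  by (simp_all add: principal_sub_def)

lemma selection_mat_carrier [simp]: "selection_mat n f k \<in> carrier_mat n k"
  by (simp add: selection_mat_def)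

lemma selection_mat_dim [simp]:
  "dim_row (selection_mat n f k) = n" "dim_col (selection_mat n f k) = k"
  by (simp_all add: selection_mat_def)

lemma mult_selection_index:
  assumes X: "X \<in> carrier_mat m n" and "i < m" "a < k" "f a < n"
  shows "(X * selection_mat n f k) $$ (i, a) = X $$ (i, f a)"
proof -
  have "(X * selection_mat n f k) $$ (i, a) = (\<Sum>j = 0..<n. X $$ (i, j) * (if j = f a then 1 else 0))"
    using assms by (simp add: selection_mat_def scalar_prod_def)
  also have "\<dots> = (\<Sum>j = 0..<n. if j = f a then X $$ (i, j) else 0)"
    by (intro sum.cong) auto
  finally show ?thesis using assms by simp
qed

lemma selection_mult_index:
  assumes X: "X \<in> carrier_mat n m" and "a < k" "j < m" "f a < n"
  shows "((selection_mat n f k)\<^sup>T * X) $$ (a, j) = X $$ (f a, j)"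
proof -
  have "((selection_mat n f k)\<^sup>T * X) $$ (a, j) = (\<Sum>i = 0..<n. (if i = f a then 1 else 0) * X $$ (i, j))"
    using assms by (simp add: selection_mat_def scalar_prod_def)
  also have "\<dots> = (\<Sum>i = 0..<n. if i = f a then X $$ (i, j) else 0)"
    by (intro sum.cong) auto
  finally show ?thesis using assms by simp
qed

lemma selection_congruence:
  assumes M: "M \<in> carrier_mat n n" and f: "\<And>a. a < k \<Longrightarrow> f a < n"
  shows "(selection_mat n f k)\<^sup>T * M * selection_mat n f k = principal_sub M f k"
proof (rule eq_matI)
  fix i j assume "i < dim_row (principal_sub M f k)" "j < dim_col (principal_sub M f k)"
  hence ij: "i < k" "j < k" by (auto simp: principal_sub_def)
  have "((selection_mat n f k)\<^sup>T * M * selection_mat n f k) $$ (i, j)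
      = ((selection_mat n f k)\<^sup>T * M) $$ (i, f j)"
    using M f ij by (intro mult_selection_index[of _ k n]) auto
  also have "\<dots> = M $$ (f i, f j)"
    using M f ij by (intro selection_mult_index[of _ n n]) auto
  finally show "((selection_mat n f k)\<^sup>T * M * selection_mat n f k) $$ (i, j) = principal_sub M f k $$ (i, j)"
    using ij by (simp add: principal_sub_def)
qed (auto simp: principal_sub_def)

lemma selection_orthonormal:
  assumes f: "\<And>a. a < k \<Longrightarrow> f a < n" and inj: "inj_on f {..<k}"
  shows "(selection_mat n f k)\<^sup>T * selection_mat n f k = 1\<^sub>m k"
proof (rule eq_matI)
  fix a b assume "a < dim_row (1\<^sub>m k)" "b < dim_col (1\<^sub>m k)"
  hence ab: "a < k" "b < k" by auto
  hence "f a = f b \<longleftrightarrow> a = b" using inj by (auto simp: inj_on_def)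
  thus "((selection_mat n f k)\<^sup>T * selection_mat n f k) $$ (a, b) = 1\<^sub>m k $$ (a, b)"
    using ab f by (subst selection_mult_index[of _ n k]) (auto simp: selection_mat_def)
qed auto

text \<open>A kernel vector of the block, padded with zeros by the selection matrix, would be a
  nonzero vector at which the quadratic form of \<open>M\<close> vanishes.\<close>

lemma spd_principal_sub_nonsingular:
  assumes spd: "symmetric_positive_definite n M"
    and f: "\<And>a. a < k \<Longrightarrow> f a < n" and inj: "inj_on f {..<k}"
  shows "det (principal_sub M f k) \<noteq> 0"
proof
  let ?V = "selection_mat n f k"
  assume "det (principal_sub M f k) = 0"
  then obtain v where v: "v \<in> carrier_vec k" "v \<noteq> 0\<^sub>v k" "principal_sub M f k *\<^sub>v v = 0\<^sub>v k"
    using det_0_iff_vec_prod_zero_field[of "principal_sub M f k" k] by auto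
  have M: "M \<in> carrier_mat n n" using spd by (simp add: symmetric_positive_definite_def)
  define w where "w = ?V *\<^sub>v v"
  have w: "w \<in> carrier_vec n" unfolding w_def by (intro carrier_vecI) simp
  have V: "?V \<in> carrier_mat n k" by simp
  have "?V\<^sup>T *\<^sub>v w = v" unfolding w_def using v selection_orthonormal[OF f inj]
    by (subst assoc_mult_mat_vec[of _ k n _ k, symmetric]) auto
  hence "w \<noteq> 0\<^sub>v n" using v(2) V by auto
  hence "0 < w \<bullet> (M *\<^sub>v w)" using spd w by (simp add: symmetric_positive_definite_def)
  also have "w \<bullet> (M *\<^sub>v w) = (M *\<^sub>v w) \<bullet> (?V *\<^sub>v v)"
    using w M comm_scalar_prod[of w n "M *\<^sub>v w"] by (simp add: w_def)
  also have "\<dots> = (?V\<^sup>T *\<^sub>v (M *\<^sub>v w)) \<bullet> v"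
    using v(1) M V w by (subst transpose_vec_mult_scalar[of ?V n k]) auto
  also have "?V\<^sup>T *\<^sub>v (M *\<^sub>v w) = (?V\<^sup>T * M * ?V) *\<^sub>v v"
    unfolding w_def using v(1) M V w[unfolded w_def]
    by (subst assoc_mult_mat_vec[of _ k n _ k], auto, subst assoc_mult_mat_vec[of _ k n _ n], auto)
  also have "\<dots> = 0\<^sub>v k" using v(3) selection_congruence[OF M f] by simp
  finally show False using v(1) by simp
qed

text \<open>Uniqueness comes from multiplying \<open>A * X * A = A\<close> by \<open>K\<close> on
  both sides; this settles the definite description.\<close>

lemma moore_penrose_inverse_invertible:
  assumes A: "A \<in> carrier_mat r r" and K: "K \<in> carrier_mat r r" and KA: "K * A = 1\<^sub>m r"
  shows "moore_penrose_inverse A = K"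
  unfolding moore_penrose_inverse_def
proof (rule the_equality)
  have AK: "A * K = 1\<^sub>m r" using mat_mult_eq_one_commute[OF K A KA] .
  show "is_moore_penrose_inverse A K"
    unfolding is_moore_penrose_inverse_def using A K AK KA by auto
  fix X assume "is_moore_penrose_inverse A X"
  hence X: "X \<in> carrier_mat r r" and AXA: "A * X * A = A"
    using A by (auto simp: is_moore_penrose_inverse_def)
  have "X = K * (A * X * A) * K"
    using A K X AK by (simp add: assoc_mult_mat[of _ r r _ r _ r])
      (simp add: assoc_mult_mat[of _ r r _ r _ r, symmetric] KA)
  thus "X = K" using A K KA by (simp add: AXA)
qed

text \<open>Maximality compares permutations, while the competitors below are injective selections
  of \<open>r\<close> indices. The complements of domain and image in \<open>{..<n}\<close> have
  equal size and can be matched.\<close>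

lemma inj_extends_to_permutation:
  fixes f :: "nat \<Rightarrow> nat" and n :: nat
  assumes inj: "inj_on f {..<k}" and f: "\<And>a. a < k \<Longrightarrow> f a < n"
  obtains \<pi> where "\<pi> permutes {..<n}" "\<And>a. a < k \<Longrightarrow> \<pi> a = f a"
proof -
  have sub: "f ` {..<k} \<subseteq> {..<n}" using f by auto
  have kn: "k \<le> n" using card_inj_on_le[OF inj sub] by auto
  have "card ({..<n} - {..<k}) = card ({..<n} - f ` {..<k})"
    using inj sub kn by (subst (1 2) card_Diff_subset) (auto simp: card_image)
  then obtain h where h: "bij_betw h ({..<n} - {..<k}) ({..<n} - f ` {..<k})"
    using finite_same_card_bij[of "{..<n} - {..<k}" "{..<n} - f ` {..<k}"] by auto
  define \<pi> where "\<pi> = (\<lambda>x. if x < k then f x else if x < n then h x else x)"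
  have "bij_betw \<pi> {..<k} (f ` {..<k})"
    using inj by (auto simp: bij_betw_def \<pi>_def inj_on_def)
  moreover have "bij_betw \<pi> ({..<n} - {..<k}) ({..<n} - f ` {..<k})"
    using h by (subst bij_betw_cong[of _ _ h]) (auto simp: \<pi>_def)
  ultimately have "bij_betw \<pi> ({..<k} \<union> ({..<n} - {..<k})) (f ` {..<k} \<union> ({..<n} - f ` {..<k}))"
    by (rule bij_betw_combine) auto
  moreover have "{..<k} \<union> ({..<n} - {..<k}) = {..<n}" "f ` {..<k} \<union> ({..<n} - f ` {..<k}) = {..<n}"
    using kn sub by auto
  ultimately have "\<pi> permutes {..<n}" by (intro bij_imp_permutes) (use kn in \<open>auto simp: \<pi>_def\<close>)
  thus thesis by (rule that) (auto simp: \<pi>_def)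
qed

section \<open>Permutation matrices, leading blocks and pseudo skeletons in terms of
  selections\<close>

lemma permutation_matrix_selection:
  "permutation_matrix n P \<longleftrightarrow> (\<exists>\<pi>. \<pi> permutes {..<n} \<and> P = (selection_mat n \<pi> n)\<^sup>T)"
proof -
  have "mat n n (\<lambda>(i, j). if j = \<pi> i then 1 else 0) = (selection_mat n \<pi> n)\<^sup>T" for \<pi>
    by (intro eq_matI) (auto simp: selection_mat_def)
  thus ?thesis unfolding permutation_matrix_def by simp
qed

lemma leading_block_principal_sub:
  assumes M: "M \<in> carrier_mat n n" and \<pi>: "\<pi> permutes {..<n}" and r: "r \<le> n"
  shows "leading_block r r ((selection_mat n \<pi> n)\<^sup>T * M * (selection_mat n \<pi> n)\<^sup>T\<^sup>T)
    = principal_sub M \<pi> r"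
proof -
  have "\<pi> a < n" if "a < n" for a using permutes_in_image[OF \<pi>, of a] that by simp
  thus ?thesis using r unfolding leading_block_def split_block_def Let_def transpose_transpose
    by (subst selection_congruence[OF M]) (auto simp: principal_sub_def intro!: eq_matI)
qed

text \<open>Principal blocks of order \<open>r\<close> are nonsingular, so the ranks tie at
  \<open>r\<close> and the volumes decide; by \<open>volume_square\<close> these are absolute
  determinants.\<close>

lemma maximal_volume_principal:
  assumes spd: "symmetric_positive_definite n M" and r: "r \<le> n" and \<pi>: "\<pi> permutes {..<n}"
    and max: "maximal_volume_pair r r M (selection_mat n \<pi> n)\<^sup>T (selection_mat n \<pi> n)\<^sup>T"
    and f: "\<And>a. a < r \<Longrightarrow> f a < n" and inj: "inj_on f {..<r}"
  shows "\<bar>det (principal_sub M f r)\<bar> \<le> \<bar>det (principal_sub M \<pi> r)\<bar>"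
proof -
  have M: "M \<in> carrier_mat n n" using spd by (simp add: symmetric_positive_definite_def)
  obtain \<sigma> where \<sigma>: "\<sigma> permutes {..<n}" "\<And>a. a < r \<Longrightarrow> \<sigma> a = f a"
    using inj_extends_to_permutation[OF inj f] by blast
  have ps: "principal_sub M f r = principal_sub M \<sigma> r"
    using \<sigma>(2) by (intro eq_matI) (auto simp: principal_sub_def)
  have rank: "vec_space.rank (dim_row (principal_sub M \<tau> r)) (principal_sub M \<tau> r) = r"
    if "\<tau> permutes {..<n}" for \<tau>
  proof -
    have "det (principal_sub M \<tau> r) \<noteq> 0"
      using r that permutes_in_image[OF that]
      by (intro spd_principal_sub_nonsingular[OF spd]) (auto intro: permutes_inj_on)
    moreover have "dim_row (principal_sub M \<tau> r) = r" by (simp add: principal_sub_def)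
    ultimately show ?thesis using vec_space.det_rank_iff[of "principal_sub M \<tau> r" r] by simp
  qed
  have "permutation_matrix n (selection_mat n \<sigma> n)\<^sup>T"
    using \<sigma>(1) permutation_matrix_selection by blast
  hence "volume r (principal_sub M \<sigma> r) \<le> volume r (principal_sub M \<pi> r)"
    using max[unfolded maximal_volume_pair_def Let_def, THEN conjunct2, THEN conjunct2,
        rule_format, of "(selection_mat n \<sigma> n)\<^sup>T" "(selection_mat n \<sigma> n)\<^sup>T"] M
    unfolding leading_block_principal_sub[OF M \<sigma>(1) r] leading_block_principal_sub[OF M \<pi> r]
      rank[OF \<sigma>(1)] rank[OF \<pi>] by simp
  thus ?thesis unfolding ps by (simp add: volume_square)
qed

text \<open>The full permutation matrices cancel, which leaves only the selection \<open>V\<close>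
  and the inverse block \<open>K\<close>.\<close>

lemma pseudo_skeleton_selection:
  assumes M: "M \<in> carrier_mat n n" and \<pi>: "\<pi> permutes {..<n}" and r: "r \<le> n"
    and K: "K \<in> carrier_mat r r" and KA: "K * principal_sub M \<pi> r = 1\<^sub>m r"
  defines "V \<equiv> selection_mat n \<pi> r"
  shows "pseudo_skeleton r r (selection_mat n \<pi> n)\<^sup>T (selection_mat n \<pi> n)\<^sup>T M
    = M * V * K * (V\<^sup>T * M)"
proof -
  let ?S = "selection_mat n \<pi> n"
  have \<pi>n: "\<pi> a < n" if "a < n" for a using permutes_in_image[OF \<pi>, of a] that by simp
  have V: "V \<in> carrier_mat n r" by (simp add: V_def)
  have S: "?S \<in> carrier_mat n n" by simp
  have SS: "?S * ?S\<^sup>T = 1\<^sub>m n"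
    using mat_mult_eq_one_commute[of "?S\<^sup>T" n ?S] selection_orthonormal[of n \<pi> n] \<pi>n permutes_inj_on[OF \<pi>]
    by simp
  obtain A B C D where split: "split_block (principal_sub M \<pi> n) r r = (A, B, C, D)"
    by (metis prod_cases4)
  have A: "A = principal_sub M \<pi> r"
    using split r by (auto simp: split_block_def Let_def principal_sub_def intro!: eq_matI)
  \<comment> \<open>The stacked blocks are the first \<open>r\<close> columns of the permuted
    matrix, that is, the columns of \<open>M\<close> chosen by \<open>V\<close> with their rows
    permuted.\<close>
  have AC: "A @\<^sub>r C = ?S\<^sup>T * (M * V)"
    using split r M V \<pi>n unfolding split_block_def Let_def append_rows_def V_def
    by (intro eq_matI) (auto simp: selection_mult_index[of _ n r] mult_selection_index[of _ n n]
      principal_sub_def simp del: index_mult_mat(1))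
  have AB: "append_columns A B = V\<^sup>T * (M * ?S)"
    using split r M V \<pi>n unfolding split_block_def Let_def append_columns_def V_def
    by (intro eq_matI) (auto simp: selection_mult_index[of _ n n] mult_selection_index[of _ n n]
      principal_sub_def simp del: index_mult_mat(1))
  have "pseudo_skeleton r r ?S\<^sup>T ?S\<^sup>T M = ?S * (?S\<^sup>T * (M * V)) * K * (V\<^sup>T * (M * ?S)) * ?S\<^sup>T"
    unfolding pseudo_skeleton_def transpose_transpose
    using selection_congruence[OF M, of n \<pi>] \<pi>n split moore_penrose_inverse_invertible[OF _ K, of A] KA A
    by (simp add: AC[unfolded A] AB[unfolded A])
  also have "?S * (?S\<^sup>T * (M * V)) = M * V"
    using S M V SS by (subst assoc_mult_mat[of _ n n _ n _ r, symmetric]) auto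
  also have "M * V * K * (V\<^sup>T * (M * ?S)) * ?S\<^sup>T = M * V * K * (V\<^sup>T * M)"
  proof -
    have MS: "M * ?S \<in> carrier_mat n n" by (rule mult_carrier_mat[OF M S])
    have "M * V * K * (V\<^sup>T * (M * ?S)) * ?S\<^sup>T = M * V * K * (V\<^sup>T * (M * ?S) * ?S\<^sup>T)"
      using mult_carrier_mat[OF mult_carrier_mat[OF M V] K] MS V
      by (intro assoc_mult_mat[of _ n r _ n _ n]) auto
    also have "V\<^sup>T * (M * ?S) * ?S\<^sup>T = V\<^sup>T * (M * ?S * ?S\<^sup>T)"
      using MS V by (intro assoc_mult_mat[of _ r n _ n _ n]) auto
    also have "M * ?S * ?S\<^sup>T = M * (?S * ?S\<^sup>T)"
      using M by (intro assoc_mult_mat[of _ n n _ n _ n]) auto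
    also have "V\<^sup>T * (M * (?S * ?S\<^sup>T)) = V\<^sup>T * M"
      unfolding SS right_mult_one_mat[OF M] ..
    finally show ?thesis .
  qed
  finally show ?thesis .
qed

section \<open>The residual of the approximation\<close>

lemma quadratic_form_two_units:
  fixes E :: "real mat"
  assumes E: "E \<in> carrier_mat n n" and i: "i < n" and j: "j < n"
  defines "x c \<equiv> unit_vec n i + c \<cdot>\<^sub>v unit_vec n j"
  shows "x c \<bullet> (E *\<^sub>v x c) = E $$ (i, i) + c * (E $$ (i, j) + E $$ (j, i)) + c * c * E $$ (j, j)"
proof -
  have u: "E *\<^sub>v unit_vec n k = col E k" if "k < n" for k
    using E that by (intro eq_vecI) auto
  have "E *\<^sub>v x c = col E i + c \<cdot>\<^sub>v col E j"
    unfolding x_def using E i j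
    by (simp add: mult_add_distrib_mat_vec[of _ n n] mult_mat_vec[of _ n n] u)
  moreover have "unit_vec n k \<bullet> col E m = E $$ (k, m)" if "k < n" "m < n" for k m
    using that E by simp
  ultimately show ?thesis unfolding x_def using E i j
    by (simp add: add_scalar_prod_distrib[of _ n] scalar_prod_add_distrib[of _ n]
      smult_scalar_prod_distrib[of _ n] scalar_prod_smult_distrib[of _ n] algebra_simps
      del: scalar_prod_left_unit)
qed

text \<open>The form is tested at e_i and at e_i plus or minus e_j. This reduces the Chebyshev norm
  of the residual to its diagonal.\<close>

lemma positive_semidefinite_entry_bound:
  fixes E :: "real mat"
  assumes E: "E \<in> carrier_mat n n" and sym: "E\<^sup>T = E"
    and psd: "\<And>x. x \<in> carrier_vec n \<Longrightarrow> 0 \<le> x \<bullet> (E *\<^sub>v x)"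
    and i: "i < n" and j: "j < n"
  shows "0 \<le> E $$ (i, i)" and "\<bar>E $$ (i, j)\<bar> \<le> (E $$ (i, i) + E $$ (j, j)) / 2"
proof -
  have q: "0 \<le> E $$ (i, i) + c * (E $$ (i, j) + E $$ (j, i)) + c * c * E $$ (j, j)" for c
    using quadratic_form_two_units[OF E i j, of c] psd[of "unit_vec n i + c \<cdot>\<^sub>v unit_vec n j"] by simp
  have "E $$ (i, j) = E $$ (j, i)" using sym E i j by (metis carrier_matD index_transpose_mat(1))
  thus "0 \<le> E $$ (i, i)" "\<bar>E $$ (i, j)\<bar> \<le> (E $$ (i, i) + E $$ (j, j)) / 2"
    using q[of 0] q[of 1] q[of "- 1"] by auto
qed

text \<open>Diagonal cofactors of a principal block are again principal minors, so maximality can be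
  applied to the diagonal of its inverse.\<close>

lemma mat_delete_principal_sub:
  assumes "j < Suc k"
  shows "mat_delete (principal_sub M f (Suc k)) j j
    = principal_sub M (\<lambda>a. f (if a < j then a else Suc a)) k"
  using assms by (intro eq_matI) (auto simp: mat_delete_def principal_sub_def)

lemma smult_one_mult_vec:
  fixes x :: "'a :: comm_semiring_1 vec"
  assumes x: "x \<in> carrier_vec n"
  shows "(c \<cdot>\<^sub>m 1\<^sub>m n) *\<^sub>v x = c \<cdot>\<^sub>v x"
proof (rule eq_vecI)
  fix i assume "i < dim_vec (c \<cdot>\<^sub>v x)"
  hence i: "i < n" using x by simp
  have "row (c \<cdot>\<^sub>m 1\<^sub>m n) i = c \<cdot>\<^sub>v unit_vec n i"
    using i by (intro eq_vecI) (auto simp: unit_vec_def)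
  thus "((c \<cdot>\<^sub>m 1\<^sub>m n) *\<^sub>v x) $ i = (c \<cdot>\<^sub>v x) $ i"
    using i x by (simp add: smult_scalar_prod_distrib[of _ n])
qed (use x in simp)

lemma cofactor_diagonal: "cofactor A j j = det (mat_delete A j j)"
  by (simp add: cofactor_def)

text \<open>The residual is studied for any injective selection whose block has inverse
  \<open>K\<close>; maximality enters only in \<open>residual_diagonal_trace\<close>.\<close>

locale spd_cross =
  fixes M K :: "real mat" and \<pi> :: "nat \<Rightarrow> nat" and n r :: nat
  assumes spd: "symmetric_positive_definite n M"
    and \<pi>n: "\<And>a. a < r \<Longrightarrow> \<pi> a < n" and inj: "inj_on \<pi> {..<r}"
    and K: "K \<in> carrier_mat r r" and KA: "K * principal_sub M \<pi> r = 1\<^sub>m r"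
begin

definition V where "V = selection_mat n \<pi> r"

text \<open>Up to reordering, the Schur complement of the selected block, padded with zeros.\<close>

definition residual where "residual = M - M * V * K * (V\<^sup>T * M)"

lemma M [simp]: "M \<in> carrier_mat n n" and M_sym: "M\<^sup>T = M"
  using spd by (auto simp: symmetric_positive_definite_def)

lemma V [simp]: "V \<in> carrier_mat n r" by (simp add: V_def)

lemma MV [simp]: "M * V \<in> carrier_mat n r"
  by (rule mult_carrier_mat[OF M V])

lemma VM [simp]: "V\<^sup>T * M \<in> carrier_mat r n"
  by (rule mult_carrier_mat[of _ r n]) auto

lemma low_rank_carrier [simp]: "M * V * K * (V\<^sup>T * M) \<in> carrier_mat n n"
  by (rule mult_carrier_mat[OF mult_carrier_mat[OF MV K] VM])

lemma residual_carrier [simp]: "residual \<in> carrier_mat n n"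
  unfolding residual_def by (rule minus_carrier_mat[OF low_rank_carrier])

lemma A_eq: "principal_sub M \<pi> r = V\<^sup>T * M * V"
  unfolding V_def using selection_congruence[OF M \<pi>n] by simp

lemma AK: "principal_sub M \<pi> r * K = 1\<^sub>m r"
  using mat_mult_eq_one_commute[OF K _ KA] by simp

lemma K_sym: "K\<^sup>T = K"
  using inverse_symmetric[OF principal_sub_carrier K _ KA] congruence_symmetric[OF M M_sym V]
  unfolding A_eq by simp

lemma residual_sym: "residual\<^sup>T = residual"
proof -
  let ?Y = "V\<^sup>T * M"
  have YT: "?Y\<^sup>T = M * V" using M V M_sym by (subst transpose_mult[of _ r n _ n]) auto
  have "M * V * K * ?Y = ?Y\<^sup>T * K * ?Y" unfolding YT ..
  hence low_sym: "(M * V * K * ?Y)\<^sup>T = M * V * K * ?Y"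
    using congruence_symmetric[OF K K_sym VM] by simp
  show ?thesis
    unfolding residual_def transpose_minus[OF M low_rank_carrier] M_sym low_sym ..
qed

text \<open>\<open>V * coef\<close> is the projector onto the range of \<open>V\<close> that is
  orthogonal for the inner product given by \<open>M\<close>.\<close>

definition coef where "coef = K * (V\<^sup>T * M)"

lemma coef_carrier [simp]: "coef \<in> carrier_mat r n"
  unfolding coef_def by (rule mult_carrier_mat[OF K VM])

lemma residual_entry:
  assumes "i < n" "j < n"
  shows "residual $$ (i, j) = M $$ (i, j) - (\<Sum>l<r. M $$ (i, \<pi> l) * coef $$ (l, j))"
proof -
  have "M * V * K * (V\<^sup>T * M) = M * V * coef"
    unfolding coef_def using MV K M V by (intro assoc_mult_mat[of _ n r _ r _ n]) auto
  hence "residual $$ (i, j) = (M - M * V * coef) $$ (i, j)"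
    unfolding residual_def by simp
  also have "\<dots> = M $$ (i, j) - (M * V * coef) $$ (i, j)"
    by (rule index_minus_mat(1))
      (unfold carrier_matD[OF mult_carrier_mat[OF MV coef_carrier]], fact+)
  also have "(M * V * coef) $$ (i, j) = (\<Sum>l<r. (M * V) $$ (i, l) * coef $$ (l, j))"
    by (rule mat_mult_entry[OF MV coef_carrier assms])
  also have "\<dots> = (\<Sum>l<r. M $$ (i, \<pi> l) * coef $$ (l, j))"
    unfolding V_def using assms M \<pi>n
    by (intro sum.cong refl arg_cong2[of _ _ _ _ "(*)"] mult_selection_index[of _ n]) auto
  finally show ?thesis .
qed

lemma coef_equation:
  assumes "k < r" "j < n"
  shows "(\<Sum>l<r. M $$ (\<pi> k, \<pi> l) * coef $$ (l, j)) = M $$ (\<pi> k, j)"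
proof -
  let ?A = "principal_sub M \<pi> r"
  have "(\<Sum>l<r. M $$ (\<pi> k, \<pi> l) * coef $$ (l, j)) = (\<Sum>l<r. ?A $$ (k, l) * coef $$ (l, j))"
    using assms by (intro sum.cong) (auto simp: principal_sub_def)
  also have "\<dots> = (?A * coef) $$ (k, j)"
    by (rule mat_mult_entry[symmetric, OF _ coef_carrier assms]) simp
  also have "?A * coef = ?A * K * (V\<^sup>T * M)"
    unfolding coef_def using K M V by (intro assoc_mult_mat[symmetric, of _ r r _ r _ n]) auto
  also have "\<dots> = V\<^sup>T * M" unfolding AK by (rule left_mult_one_mat[OF VM])
  also have "(V\<^sup>T * M) $$ (k, j) = M $$ (\<pi> k, j)"
    unfolding V_def using assms M \<pi>n by (intro selection_mult_index[of _ n n]) auto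
  finally show ?thesis .
qed

lemma residual_zero_row: "k < r \<Longrightarrow> j < n \<Longrightarrow> residual $$ (\<pi> k, j) = 0"
  using residual_entry[of "\<pi> k" j] coef_equation[of k j] \<pi>n by simp

text \<open>With \<open>y\<close> the part of \<open>x\<close> that is \<open>M\<close>-orthogonal
  to the range of \<open>V\<close>, the form of the residual at \<open>x\<close> equals the form of
  \<open>M\<close> at \<open>y\<close>.\<close>

lemma residual_psd:
  assumes x: "x \<in> carrier_vec n"
  shows "0 \<le> x \<bullet> (residual *\<^sub>v x)"
proof -
  define z where "z = coef *\<^sub>v x"
  define y where "y = x - V *\<^sub>v z"
  have z: "z \<in> carrier_vec r" unfolding z_def by (intro mult_mat_vec_carrier[OF coef_carrier x])
  have Vz: "V *\<^sub>v z \<in> carrier_vec n" by (intro mult_mat_vec_carrier[OF V z])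
  have y: "y \<in> carrier_vec n" unfolding y_def using x Vz by simp
  have My: "M *\<^sub>v y \<in> carrier_vec n" by (intro mult_mat_vec_carrier[OF M y])
  have MVc: "M * V * coef \<in> carrier_mat n n" by (rule mult_carrier_mat[OF MV coef_carrier])
  have "M * V * K * (V\<^sup>T * M) = M * V * coef"
    unfolding coef_def using K M V by (intro assoc_mult_mat[of _ n r _ r _ n]) auto
  hence "residual *\<^sub>v x = M *\<^sub>v x - (M * V * coef) *\<^sub>v x"
    unfolding residual_def using minus_mult_distrib_mat_vec[OF M MVc x] by simp
  also have "(M * V * coef) *\<^sub>v x = (M * V) *\<^sub>v z"
    unfolding z_def using x by (intro assoc_mult_mat_vec[of _ n r _ n]) auto
  also have "\<dots> = M *\<^sub>v (V *\<^sub>v z)"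
    using z by (intro assoc_mult_mat_vec[of _ n n _ r]) auto
  also have "M *\<^sub>v x - M *\<^sub>v (V *\<^sub>v z) = M *\<^sub>v y"
    unfolding y_def using mult_minus_distrib_mat_vec[OF M x Vz] by simp
  finally have Ex: "residual *\<^sub>v x = M *\<^sub>v y" .
  \<comment> \<open>The residual vanishes on the selected rows, so \<open>M *\<^sub>v y\<close> is
    orthogonal to the range of \<open>V\<close> and \<open>x\<close> may be replaced by
    \<open>y\<close> on the left of the form.\<close>
  have "V\<^sup>T *\<^sub>v (residual *\<^sub>v x) = (V\<^sup>T * residual) *\<^sub>v x"
    using x by (intro assoc_mult_mat_vec[symmetric, of _ r n _ n]) auto
  also have "V\<^sup>T * residual = 0\<^sub>m r n"
  proof (rule eq_matI)
    fix k j assume "k < dim_row (0\<^sub>m r n :: real mat)" "j < dim_col (0\<^sub>m r n :: real mat)"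
    hence kj: "k < r" "j < n" by auto
    show "(V\<^sup>T * residual) $$ (k, j) = 0\<^sub>m r n $$ (k, j)"
      unfolding V_def using kj \<pi>n residual_zero_row
      by (subst selection_mult_index[of _ n n]) auto
  qed (use V residual_carrier in \<open>auto simp del: V residual_carrier\<close>)
  also have "0\<^sub>m r n *\<^sub>v x = 0\<^sub>v r" using x by auto
  finally have orth: "V\<^sup>T *\<^sub>v (M *\<^sub>v y) = 0\<^sub>v r" unfolding Ex .
  have "(M *\<^sub>v y) \<bullet> (V *\<^sub>v z) = (V\<^sup>T *\<^sub>v (M *\<^sub>v y)) \<bullet> z"
    using z My by (intro transpose_vec_mult_scalar[symmetric, of V n r]) auto
  hence 0: "(V *\<^sub>v z) \<bullet> (M *\<^sub>v y) = 0"
    unfolding orth using z comm_scalar_prod[OF Vz My] by simp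
  have "y \<bullet> (M *\<^sub>v y) = x \<bullet> (M *\<^sub>v y) - (V *\<^sub>v z) \<bullet> (M *\<^sub>v y)"
    unfolding y_def using minus_scalar_prod_distrib[OF x Vz My] by (simp add: y_def)
  hence "x \<bullet> (residual *\<^sub>v x) = y \<bullet> (M *\<^sub>v y)" unfolding Ex 0 by simp
  moreover have "0 \<le> y \<bullet> (M *\<^sub>v y)"
  proof (cases "y = 0\<^sub>v n")
    case True
    thus ?thesis using My by simp
  next
    case False
    thus ?thesis using spd y by (auto simp: symmetric_positive_definite_def less_imp_le)
  qed
  ultimately show ?thesis by simp
qed

text \<open>The bordered block \<open>N\<close> maps \<open>x = (- A\<^sup>-\<^sup>1 b, 1)\<close> to \<open>(0, E\<^sub>i\<^sub>i)\<close>; multiply by the adjugate of \<open>N\<close>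
  and compare last components.\<close>

lemma residual_diagonal_det:
  assumes i: "i < n"
  defines "g \<equiv> \<lambda>a. if a < r then \<pi> a else i"
  shows "residual $$ (i, i) * det (principal_sub M \<pi> r) = det (principal_sub M g (Suc r))"
proof -
  let ?N = "principal_sub M g (Suc r)"
  have N: "?N \<in> carrier_mat (Suc r) (Suc r)" by simp
  define x where "x = vec (Suc r) (\<lambda>k. if k < r then - coef $$ (k, i) else 1)"
  have x: "x \<in> carrier_vec (Suc r)" by (simp add: x_def)
  have Nx: "(?N *\<^sub>v x) $ k = (if k < r then 0 else residual $$ (i, i))" if "k < Suc r" for k
  proof -
    have "(?N *\<^sub>v x) $ k = (\<Sum>l<Suc r. M $$ (g k, g l) * x $ l)"
      using that by (simp add: mult_mat_vec_def scalar_prod_def principal_sub_def x_def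
        atLeast0LessThan del: sum.lessThan_Suc)
    also have "\<dots> = M $$ (g k, i) - (\<Sum>l<r. M $$ (g k, \<pi> l) * coef $$ (l, i))"
      by (simp add: g_def x_def sum_negf)
    finally show ?thesis
      using that i coef_equation[of k i] residual_entry[of i i] by (auto simp: g_def)
  qed
  have adj: "adj_mat ?N \<in> carrier_mat (Suc r) (Suc r)" using adj_mat(1)[OF N] .
  have "adj_mat ?N *\<^sub>v (?N *\<^sub>v x) = (adj_mat ?N * ?N) *\<^sub>v x"
    using assoc_mult_mat_vec[OF adj N x] by simp
  also have "\<dots> = det ?N \<cdot>\<^sub>v x"
    unfolding adj_mat(3)[OF N] by (rule smult_one_mult_vec[OF x])
  finally have "(adj_mat ?N *\<^sub>v (?N *\<^sub>v x)) $ r = det ?N"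
    by (simp add: x_def)
  moreover have "(adj_mat ?N *\<^sub>v (?N *\<^sub>v x)) $ r = (\<Sum>k<Suc r. adj_mat ?N $$ (r, k) * (?N *\<^sub>v x) $ k)"
    by (rule mat_mult_vec_entry[OF adj mult_mat_vec_carrier[OF N x]]) simp
  moreover have "\<dots> = adj_mat ?N $$ (r, r) * residual $$ (i, i)"
    by (simp add: Nx del: index_mult_mat_vec)
  moreover have "adj_mat ?N $$ (r, r) = det (principal_sub M \<pi> r)"
  proof -
    have "mat_delete ?N r r = principal_sub M \<pi> r"
      unfolding mat_delete_principal_sub[OF lessI] by (auto simp: principal_sub_def g_def intro!: eq_matI)
    thus ?thesis by (simp add: adj_mat_def cofactor_diagonal)
  qed
  ultimately show ?thesis by simp
qed

text \<open>Here the spectral bound for compressions meets maximality: both estimate the trace of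
  the inverse of the block bordered by \<open>i\<close>.\<close>

lemma residual_diagonal_trace:
  assumes max: "\<And>f. (\<And>a. a < r \<Longrightarrow> f a < n) \<Longrightarrow> inj_on f {..<r}
      \<Longrightarrow> \<bar>det (principal_sub M f r)\<bar> \<le> \<bar>det (principal_sub M \<pi> r)\<bar>"
    and U: "U \<in> carrier_mat n n" and UU: "U\<^sup>T * U = 1\<^sub>m n" and D: "U\<^sup>T * M * U = mat_diag n l"
    and pos: "\<And>k. k < n \<Longrightarrow> 0 < l k"
    and dec: "\<And>i j. i \<le> j \<Longrightarrow> j < n \<Longrightarrow> l j \<le> l i"
    and i: "i < n" and rn: "Suc r \<le> n"
  shows "residual $$ (i, i) * (\<Sum>k<Suc r. 1 / l k) \<le> Suc r"
proof (cases "i \<in> \<pi> ` {..<r}")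
  \<comment> \<open>An index of the block cannot border it, but there the residual is zero.\<close>
  case True
  then obtain a where "a < r" "i = \<pi> a" by auto
  thus ?thesis using residual_zero_row[of a i] i by simp
next
  case False
  define g where "g = (\<lambda>a. if a < r then \<pi> a else i)"
  have gn: "g a < n" for a using \<pi>n i by (simp add: g_def)
  have g_inj: "inj_on g {..<Suc r}"
    using inj False unfolding inj_on_def g_def by (auto simp: less_Suc_eq)
  let ?N = "principal_sub M g (Suc r)" and ?W = "selection_mat n g (Suc r)"
  let ?A = "principal_sub M \<pi> r"
  have N: "?N \<in> carrier_mat (Suc r) (Suc r)" by simp
  have dN: "det ?N \<noteq> 0" using spd_principal_sub_nonsingular[OF spd gn g_inj] .
  have N_eq: "?N = ?W\<^sup>T * M * ?W" using selection_congruence[OF M gn] by simp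
  \<comment> \<open>The inverse is written through the adjugate so that its diagonal entries are
    quotients of principal minors.\<close>
  define L where "L = (1 / det ?N) \<cdot>\<^sub>m adj_mat ?N"
  have adj: "adj_mat ?N \<in> carrier_mat (Suc r) (Suc r)" using adj_mat(1)[OF N] .
  have L: "L \<in> carrier_mat (Suc r) (Suc r)" unfolding L_def using adj by simp
  have LN: "L * ?N = 1\<^sub>m (Suc r)"
    unfolding L_def using mult_smult_assoc_mat[OF adj N] adj_mat(3)[OF N] dN
    by (auto intro!: eq_matI)
  have Lsym: "L\<^sup>T = L"
    using inverse_symmetric[OF N L _ LN] congruence_symmetric[OF M M_sym, of ?W "Suc r"]
    unfolding N_eq by simp
  have "(\<Sum>k<Suc r. 1 / l k) \<le> (\<Sum>k<Suc r. L $$ (k, k))"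
    by (rule trace_inverse_compression[OF M U UU D pos dec _ selection_orthonormal[OF gn g_inj] rn L Lsym])
      (use LN in \<open>simp_all add: N_eq\<close>)
  \<comment> \<open>Each diagonal cofactor comes from a principal block competing with
    \<open>?A\<close>. The minors have only been shown to be nonzero, hence the absolute
    values.\<close>
  also have "\<dots> \<le> (\<Sum>k<Suc r. \<bar>det ?A\<bar> / \<bar>det ?N\<bar>)"
  proof (rule sum_mono)
    fix k assume k: "k \<in> {..<Suc r}"
    let ?f = "\<lambda>a. g (if a < k then a else Suc a)"
    have "inj_on ?f {..<r}"
    proof (rule inj_onI)
      fix a b assume ab: "a \<in> {..<r}" "b \<in> {..<r}" and eq: "?f a = ?f b"
      have "(if a < k then a else Suc a) = (if b < k then b else Suc b)"
        by (rule inj_onD[OF g_inj eq]) (use ab in auto)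
      thus "a = b" by (auto split: if_splits)
    qed
    hence dk: "\<bar>det (principal_sub M ?f r)\<bar> \<le> \<bar>det ?A\<bar>" using gn by (intro max) auto
    have Lk: "L $$ (k, k) = det (principal_sub M ?f r) / det ?N"
      using k adj unfolding L_def
      by (simp add: adj_mat_def cofactor_diagonal mat_delete_principal_sub)
    have "L $$ (k, k) \<le> \<bar>L $$ (k, k)\<bar>" by (rule abs_ge_self)
    also have "\<dots> = \<bar>det (principal_sub M ?f r)\<bar> / \<bar>det ?N\<bar>"
      unfolding Lk by (rule abs_divide)
    also have "\<dots> \<le> \<bar>det ?A\<bar> / \<bar>det ?N\<bar>" by (rule divide_right_mono[OF dk abs_ge_zero])
    finally show "L $$ (k, k) \<le> \<bar>det ?A\<bar> / \<bar>det ?N\<bar>" .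
  qed
  finally have "(\<Sum>k<Suc r. 1 / l k) \<le> Suc r * (\<bar>det ?A\<bar> / \<bar>det ?N\<bar>)" by simp
  moreover have R0: "0 \<le> residual $$ (i, i)"
    using positive_semidefinite_entry_bound(1)[OF residual_carrier residual_sym residual_psd i i] .
  ultimately have "residual $$ (i, i) * (\<Sum>k<Suc r. 1 / l k)
      \<le> residual $$ (i, i) * (Suc r * (\<bar>det ?A\<bar> / \<bar>det ?N\<bar>))"
    by (rule mult_left_mono)
  also have "\<dots> = Suc r * (\<bar>residual $$ (i, i) * det ?A\<bar> / \<bar>det ?N\<bar>)"
    using R0 by (simp add: abs_mult)
  also have "\<bar>residual $$ (i, i) * det ?A\<bar> / \<bar>det ?N\<bar> = 1"
    unfolding residual_diagonal_det[OF i, folded g_def] using dN by simp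
  finally show ?thesis by simp
qed

end

section \<open>Comparison with an integral, and the final estimate\<close>

lemma sum_powr_lower_bound:
  fixes s :: real
  assumes s: "0 < s"
  shows "real m powr (s + 1) / (s + 1) \<le> (\<Sum>k<m. real (Suc k) powr s)"
proof (induction m)
  case 0
  thus ?case by simp
next
  case (Suc m)
  \<comment> \<open>The left side is the integral of (s + 1) t^s over [m, m + 1]; monotonicity
    bounds it by the value at the right endpoint.\<close>
  have "real (Suc m) powr (s + 1) - real m powr (s + 1) \<le> (s + 1) * real (Suc m) powr s"
  proof (cases "m = 0")
    \<comment> \<open>Separated because the derivative rule for \<open>powr\<close> needs a positive
      base; here the claim is \<open>1 \<le> s + 1\<close>.\<close>
    case True
    thus ?thesis using s by simp
  next
    case False
    have "\<exists>z. real m < z \<and> z < real (Suc m) \<and> real (Suc m) powr (s + 1) - real m powr (s + 1)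
        = (real (Suc m) - real m) * ((s + 1) * z powr s)"
      using False by (intro MVT2) (auto intro!: derivative_eq_intros)
    then obtain z where z: "real m < z" "z < real (Suc m)"
      and eq: "real (Suc m) powr (s + 1) - real m powr (s + 1) = (s + 1) * z powr s"
      by auto
    have "z powr s \<le> real (Suc m) powr s"
      using z s by (intro powr_mono2) auto
    thus ?thesis unfolding eq using s by simp
  qed
  hence "(real (Suc m) powr (s + 1) - real m powr (s + 1)) / (s + 1) \<le> real (Suc m) powr s"
    using s by (simp add: pos_divide_le_eq mult.commute del: of_nat_Suc)
  thus ?case using Suc by (simp add: diff_divide_distrib)
qed

theorem corollary1:
  fixes M Mhat :: "real mat" and n r :: nat
    and eig :: "nat \<Rightarrow> real" and C1 C2 s :: real
  assumes "symmetric_positive_definite n M"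
    and "map eig [1..<n + 1] = eigenvalues_desc M"
    and "1 \<le> r" and "r \<le> n - 1"
    and "spd_maximal_volume_pseudo_skeleton r M Mhat"
    and "0 < C1" and "0 < C2" and "0 < s"
    and "\<And>k. k \<in> {1..n} \<Longrightarrow>
           C1 * real k powr (- s) \<le> eig k \<and> eig k \<le> C2 * real k powr (- s)"
  shows "chebyshev_norm (Mhat - M) \<le> (s + 1) * (C2 / C1) * eig (r + 1)"
proof -
  note spd = assms(1) and eig = assms(9)
  have M: "M \<in> carrier_mat n n" and sym: "M\<^sup>T = M"
    using spd by (auto simp: symmetric_positive_definite_def)
  have rn: "Suc r \<le> n" using assms(3,4) by simp
  define l where "l = (\<lambda>k. eigenvalues_desc M ! k)"
  \<comment> \<open>\<open>l\<close> counts from 0 and \<open>eig\<close> from 1, so the eigenvalue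
    in the bound is \<open>l r\<close>.\<close>
  have l: "l k = eig (Suc k)" if "k < n" for k
    unfolding l_def assms(2)[symmetric] using that by (simp del: upt_Suc)
  have pos: "0 < l k" if "k < n" for k
    using eig[of "Suc k"] that assms(6) unfolding l[OF that]
    by (smt (verit) atLeastAtMost_iff Suc_leI le_add1 mult_pos_pos of_nat_0_less_iff plus_1_eq_Suc powr_gt_zero zero_less_Suc)
  have dec: "l j \<le> l i" if "i \<le> j" "j < n" for i j
    using eigenvalues_desc_symmetric(2,3)[OF M sym] that unfolding l_def
    by (cases "i = j") (auto simp: sorted_wrt_iff_nth_less)
  obtain U where U: "U \<in> carrier_mat n n" "U\<^sup>T * U = 1\<^sub>m n" "U\<^sup>T * M * U = mat_diag n l"
    using spectral_theorem_symmetric[OF M sym eigenvalues_desc_symmetric(1)[OF M sym]]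
    unfolding l_def by blast
  obtain P where P: "maximal_volume_pair r r M P P" "Mhat = pseudo_skeleton r r P P M"
    using assms(5) unfolding spd_maximal_volume_pseudo_skeleton_def by blast
  have "permutation_matrix n P" using P(1) M by (simp add: maximal_volume_pair_def)
  then obtain \<pi> where \<pi>: "\<pi> permutes {..<n}" and P_eq: "P = (selection_mat n \<pi> n)\<^sup>T"
    using permutation_matrix_selection by blast
  note max = P(1)[unfolded P_eq] and Mhat = P(2)[unfolded P_eq]
  have \<pi>n: "\<pi> a < n" if "a < r" for a using permutes_in_image[OF \<pi>, of a] that rn by simp
  have inj: "inj_on \<pi> {..<r}" using permutes_inj_on[OF \<pi>] .
  let ?A = "principal_sub M \<pi> r"
  have dA: "det ?A \<noteq> 0" using spd_principal_sub_nonsingular[OF spd \<pi>n inj] .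
  define K where "K = (1 / det ?A) \<cdot>\<^sub>m adj_mat ?A"
  have adj: "adj_mat ?A \<in> carrier_mat r r" using adj_mat(1)[of ?A r] by simp
  have K: "K \<in> carrier_mat r r" unfolding K_def using adj by simp
  have KA: "K * ?A = 1\<^sub>m r"
    unfolding K_def using mult_smult_assoc_mat[OF adj, of ?A r] adj_mat(3)[of ?A r] dA
    by (auto intro!: eq_matI)
  interpret spd_cross M K \<pi> n r
    using spd \<pi>n inj K KA by unfold_locales
  have "Mhat = M * V * K * (V\<^sup>T * M)"
    unfolding Mhat V_def using pseudo_skeleton_selection[OF M \<pi> _ K KA] rn by simp
  hence Mhat_c: "Mhat \<in> carrier_mat n n" and res: "residual = M - Mhat"
    by (simp_all add: residual_def)
  let ?c = "(s + 1) * (C2 / C1) * eig (r + 1)"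
  have diag: "residual $$ (i, i) \<le> ?c" if i: "i < n" for i
  proof -
    let ?m = "real (Suc r)"
    have R0: "0 \<le> residual $$ (i, i)"
      using positive_semidefinite_entry_bound(1)[OF residual_carrier residual_sym residual_psd i i] .
    have "?m powr (s + 1) / (s + 1) / C2 \<le> (\<Sum>k<Suc r. real (Suc k) powr s) / C2"
      using sum_powr_lower_bound[OF assms(8), of "Suc r"] assms(7) by (intro divide_right_mono) auto
    \<comment> \<open>The upper eigenvalue bound is inverted term by term.\<close>
    also have "\<dots> \<le> (\<Sum>k<Suc r. 1 / l k)"
      unfolding sum_divide_distrib
    proof (rule sum_mono)
      fix k assume "k \<in> {..<Suc r}"
      hence k: "k < n" using rn by simp
      have "l k \<le> C2 * real (Suc k) powr (- s)" using eig[of "Suc k"] l[OF k] k by simp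
      hence "1 / (C2 * real (Suc k) powr (- s)) \<le> 1 / l k"
        using pos[OF k] assms(7) by (intro divide_left_mono) auto
      thus "real (Suc k) powr s / C2 \<le> 1 / l k" by (simp add: powr_minus field_simps)
    qed
    finally have "residual $$ (i, i) * (?m powr (s + 1) / (s + 1) / C2)
        \<le> residual $$ (i, i) * (\<Sum>k<Suc r. 1 / l k)"
      using R0 by (rule mult_left_mono)
    also have "\<dots> \<le> ?m"
      by (rule residual_diagonal_trace[OF _ U pos dec i rn])
        (use maximal_volume_principal[OF spd _ \<pi> max] rn in auto)
    finally have "residual $$ (i, i) * ?m powr (s + 1) / ((s + 1) * C2) \<le> ?m"
      by (simp only: times_divide_eq_right divide_divide_eq_left)
    hence "residual $$ (i, i) * ?m powr (s + 1) \<le> ?m * ((s + 1) * C2)"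
      using assms(7,8) by (subst (asm) pos_divide_le_eq) auto
    \<comment> \<open>One factor \<open>?m\<close> cancels against the \<open>Suc r\<close> from the
      trace bound, leaving the exponent \<open>s\<close> of the eigenvalue decay.\<close>
    also have "?m powr (s + 1) = ?m * ?m powr s" by (simp add: powr_add)
    finally have "?m * (residual $$ (i, i) * ?m powr s) \<le> ?m * ((s + 1) * C2)"
      by (simp only: mult.left_commute)
    hence "residual $$ (i, i) * ?m powr s \<le> (s + 1) * C2"
      by (rule mult_left_le_imp_le) simp
    hence "residual $$ (i, i) \<le> (s + 1) * C2 * ?m powr (- s)"
      by (simp add: powr_minus field_simps del: of_nat_Suc)
    \<comment> \<open>\<open>C1\<close> is inserted so that the lower eigenvalue bound at index
      \<open>r + 1\<close> can replace the power by \<open>eig (r + 1)\<close>; hence the ratio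
      \<open>C2 / C1\<close>.\<close>
    also have "\<dots> = (s + 1) * (C2 / C1) * (C1 * ?m powr (- s))"
      using assms(6) by simp
    also have "\<dots> \<le> ?c"
      using eig[of "Suc r"] rn assms(6-8) by (intro mult_left_mono) auto
    finally show ?thesis .
  qed
  have entry: "\<bar>(Mhat - M) $$ (i, j)\<bar> \<le> ?c" if "i < n" "j < n" for i j
  proof -
    have "\<bar>(Mhat - M) $$ (i, j)\<bar> = \<bar>residual $$ (i, j)\<bar>"
      unfolding res using that carrier_matD[OF M] Mhat_c by (simp add: abs_minus_commute)
    also have "\<dots> \<le> (residual $$ (i, i) + residual $$ (j, j)) / 2"
      by (rule positive_semidefinite_entry_bound(2)[OF residual_carrier residual_sym residual_psd that])
    also have "\<dots> \<le> (?c + ?c) / 2"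
      by (intro divide_right_mono add_mono diag that) simp
    finally show ?thesis by (simp only: field_sum_of_halves add_divide_distrib)
  qed
  have entries: "{f i j | i j. i < n \<and> j < n} = (\<lambda>(i, j). f i j) ` ({..<n} \<times> {..<n})"
    for f :: "nat \<Rightarrow> nat \<Rightarrow> real" by auto
  have "chebyshev_norm (Mhat - M) = Max ((\<lambda>(i, j). \<bar>(Mhat - M) $$ (i, j)\<bar>) ` ({..<n} \<times> {..<n}))"
    unfolding chebyshev_norm_def index_minus_mat(2,3) carrier_matD[OF M] entries ..
  also have "\<dots> \<le> ?c"
  proof (rule Max.boundedI)
    \<comment> \<open>\<open>Suc r \<le> n\<close> provides an entry; the maximum of an empty set
      would be unspecified.\<close>
    show "(\<lambda>(i, j). \<bar>(Mhat - M) $$ (i, j)\<bar>) ` ({..<n} \<times> {..<n}) \<noteq> {}"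
      using rn by (auto simp: lessThan_empty_iff)
    fix a assume "a \<in> (\<lambda>(i, j). \<bar>(Mhat - M) $$ (i, j)\<bar>) ` ({..<n} \<times> {..<n})"
    then obtain i j where ij: "i < n" "j < n" and a: "a = \<bar>(Mhat - M) $$ (i, j)\<bar>"
      by (elim imageE SigmaE) (simp only: lessThan_iff case_prod_conv)
    show "a \<le> ?c" unfolding a by (rule entry[OF ij])
  qed simp
  finally show ?thesis .
qed

end
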